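(* There exists an abelian subgroup of $\mathrm{Aut}(\mathbb{U})$ of exponent $2$ that acts transitively on $\mathbb{U}$.
   Context: $\mathbb{U}$ denotes the Urysohn space: the complete separable metric space, unique up to isometry, that is homogeneous (any isometry between finite subsets extends to an isometry of $\mathbb{U}$ onto itself) and universal (every complete separable metric space embeds isometrically in it). $\mathrm{Aut}(\mathbb{U})$ is the group of all isometries of $\mathbb{U}$ onto itself. *)

theory Defs
  imports "HOL-Analysis.Analysis" "HOL-Algebra.Group_Action"
begin

section \<open>Isometries\<close>

definition isometric_embedding :: "'a metric \<Rightarrow> 'b metric \<Rightarrow> ('a \<Rightarrow> 'b) \<Rightarrow> bool" where
  "isometric_embedding X Y f \<longleftrightarrow>
     f \<in> mspace X \<rightarrow> mspace Y \<and>
     (\<forall>x\<in>mspace X. \<forall>y\<in>mspace X. mdist Y (f x) (f y) = mdist X x y)"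

definition onto_isometry :: "'a metric \<Rightarrow> 'b metric \<Rightarrow> ('a \<Rightarrow> 'b) \<Rightarrow> bool" where
  "onto_isometry X Y f \<longleftrightarrow> isometric_embedding X Y f \<and> f ` mspace X = mspace Y"

text \<open>As in \<^const>\<open>BijGroup\<close>, self-maps of the space are represented by functions that are
  \<^const>\<open>undefined\<close> outside of it, so that each isometry has exactly one representative.\<close>

definition isometry_group :: "'a metric \<Rightarrow> ('a \<Rightarrow> 'a) monoid" where
  "isometry_group X =
     (BijGroup (mspace X))\<lparr>carrier := {f \<in> Bij (mspace X). onto_isometry X X f}\<rparr>"


section \<open>The Urysohn space\<close>

definition polish_metric :: "'a metric \<Rightarrow> bool" where
  "polish_metric X \<longleftrightarrow> mcomplete_of X \<and> separable_space (mtopology_of X)"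

definition homogeneous_metric :: "'a metric \<Rightarrow> bool" where
  "homogeneous_metric X \<longleftrightarrow>
     (\<forall>A B f. finite A \<and> finite B \<and> A \<subseteq> mspace X \<and> B \<subseteq> mspace X \<and>
        onto_isometry (submetric X A) (submetric X B) f \<longrightarrow>
        (\<exists>g. onto_isometry X X g \<and> (\<forall>x\<in>A. g x = f x)))"

text \<open>A formula cannot quantify over types. A separable metric space has at most the cardinality
  of the continuum, so it is isometric to one whose points are real numbers (with an arbitrary
  metric, unrelated to the usual one); lemma \<open>universal_metricD\<close> below recovers the embedding of
  complete separable metric spaces over every type.\<close>

definition universal_metric :: "'a metric \<Rightarrow> bool" where
  "universal_metric X \<longleftrightarrow>
     (\<forall>Y :: real metric. polish_metric Y \<longrightarrow> (\<exists>f. isometric_embedding Y X f))"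

definition urysohn_space :: "'a metric \<Rightarrow> bool" where
  "urysohn_space X \<longleftrightarrow> polish_metric X \<and> homogeneous_metric X \<and> universal_metric X"


section \<open>Exponent of a group\<close>

definition has_exponent :: "('a, 'b) monoid_scheme \<Rightarrow> nat \<Rightarrow> bool" where
  "has_exponent G n \<longleftrightarrow>
     0 < n \<and> (\<forall>x\<in>carrier G. x [^]\<^bsub>G\<^esub> n = \<one>\<^bsub>G\<^esub>) \<and>
     (\<forall>m. 0 < m \<and> (\<forall>x\<in>carrier G. x [^]\<^bsub>G\<^esub> m = \<one>\<^bsub>G\<^esub>) \<longrightarrow> n \<le> m)"


section \<open>Adequacy of the definitions\<close>

lemma subgroup_isometries:
  "subgroup {f \<in> Bij (mspace X). onto_isometry X X f} (BijGroup (mspace X))"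
    (is "subgroup ?H ?G")
proof -
  interpret group ?G by (rule group_BijGroup)
  have carr: "carrier ?G = Bij (mspace X)" by (simp add: BijGroup_def)
  show ?thesis
  proof (rule subgroupI)
    show "?H \<subseteq> carrier ?G" by (auto simp: carr)
    have "(\<lambda>x\<in>mspace X. x) \<in> ?H"
      by (auto simp: id_Bij onto_isometry_def isometric_embedding_def)
    then show "?H \<noteq> {}" by blast
  next
    fix f assume f: "f \<in> ?H"
    then have fB: "f \<in> Bij (mspace X)" and im: "f ` mspace X = mspace X"
      and d: "\<And>x y. x \<in> mspace X \<Longrightarrow> y \<in> mspace X \<Longrightarrow> mdist X (f x) (f y) = mdist X x y"
      by (auto simp: onto_isometry_def isometric_embedding_def)
    let ?g = "\<lambda>x\<in>mspace X. inv_into (mspace X) f x"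
    have inv: "inv\<^bsub>?G\<^esub> f = ?g" by (rule inv_BijGroup[OF fB])
    have gB: "?g \<in> Bij (mspace X)" by (rule restrict_inv_into_Bij[OF fB])
    then have gim: "?g ` mspace X = mspace X" by (auto simp: Bij_def bij_betw_def)
    have "mdist X (?g x) (?g y) = mdist X x y" if "x \<in> mspace X" "y \<in> mspace X" for x y
      using that d[of "inv_into (mspace X) f x" "inv_into (mspace X) f y"] im
      by (simp add: inv_into_into f_inv_into_f)
    then have "onto_isometry X X (?g)"
      unfolding onto_isometry_def isometric_embedding_def
      using gim Bij_imp_funcset[OF gB] by simp
    with gB show "inv\<^bsub>?G\<^esub> f \<in> ?H"
      unfolding inv by simp
  next
    fix f g assume "f \<in> ?H" "g \<in> ?H"
    then have fB: "f \<in> Bij (mspace X)" and fim: "f ` mspace X = mspace X"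
      and fd: "\<And>x y. x \<in> mspace X \<Longrightarrow> y \<in> mspace X \<Longrightarrow> mdist X (f x) (f y) = mdist X x y"
      and gB: "g \<in> Bij (mspace X)" and gim: "g ` mspace X = mspace X"
      and gd: "\<And>x y. x \<in> mspace X \<Longrightarrow> y \<in> mspace X \<Longrightarrow> mdist X (g x) (g y) = mdist X x y"
      by (auto simp: onto_isometry_def isometric_embedding_def)
    have eq: "f \<otimes>\<^bsub>?G\<^esub> g = compose (mspace X) f g"
      using fB gB by (simp add: BijGroup_def)
    have cB: "compose (mspace X) f g \<in> Bij (mspace X)" by (rule compose_Bij[OF fB gB])
    then have cim: "compose (mspace X) f g ` mspace X = mspace X"
      by (auto simp: Bij_def bij_betw_def)
    have "mdist X (compose (mspace X) f g x) (compose (mspace X) f g y) = mdist X x y"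
      if "x \<in> mspace X" "y \<in> mspace X" for x y
    proof -
      have "g x \<in> mspace X" "g y \<in> mspace X" using that gim by auto
      then show ?thesis using that fd gd by (simp add: compose_eq)
    qed
    then have "onto_isometry X X (compose (mspace X) f g)"
      unfolding onto_isometry_def isometric_embedding_def
      using cim Bij_imp_funcset[OF cB] by simp
    with cB show "f \<otimes>\<^bsub>?G\<^esub> g \<in> ?H"
      unfolding eq by simp
  qed
qed

lemma group_isometry_group: "group (isometry_group X)"
  unfolding isometry_group_def
  by (rule subgroup.subgroup_is_group[OF subgroup_isometries group_BijGroup])

lemma separable_metric_lepoll_real:
  fixes Y :: "'b metric"
  assumes "separable_space (mtopology_of Y)"
  shows "mspace Y \<lesssim> (UNIV :: real set)"
proof -
  interpret Metric_space "mspace Y" "mdist Y" by (rule Metric_space_mspace_mdist)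
  obtain D where D: "countable D" "D \<subseteq> mspace Y" "mtopology closure_of D = mspace Y"
    using assms by (auto simp: separable_space_def mtopology_of_def)
  define c where "c x = {(a, k :: nat). a \<in> D \<and> mdist Y x a < inverse (real (Suc k))}" for x
  have "inj_on c (mspace Y)"
  proof (rule inj_onI, rule ccontr)
    fix x y assume xy: "x \<in> mspace Y" "y \<in> mspace Y" "c x = c y" "x \<noteq> y"
    then have "0 < mdist Y x y / 2" by simp
    then obtain k where k: "inverse (real (Suc k)) < mdist Y x y / 2"
      using reals_Archimedean by blast
    have "x \<in> mtopology closure_of D" using D xy by simp
    moreover have "0 < inverse (real (Suc k))" by simp
    ultimately obtain a where a: "a \<in> D" "a \<in> mball x (inverse (real (Suc k)))"
      unfolding metric_closure_of by blast
    then have "(a, k) \<in> c x" by (auto simp: c_def)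
    then have "(a, k) \<in> c y" using xy by simp
    then have "mdist Y y a < inverse (real (Suc k))" by (auto simp: c_def)
    moreover have "mdist Y x a < inverse (real (Suc k))" using a by auto
    moreover have "mdist Y x y \<le> mdist Y x a + mdist Y y a"
      using xy a D triangle' by auto
    ultimately show False using k by linarith
  qed
  moreover have "inj_on (image (to_nat_on (D \<times> (UNIV :: nat set)))) (c ` mspace Y)"
  proof (rule inj_on_subset)
    show "inj_on (image (to_nat_on (D \<times> (UNIV :: nat set)))) (Pow (D \<times> UNIV))"
      by (rule inj_on_image_Pow) (use D(1) in \<open>simp add: inj_on_to_nat_on\<close>)
    show "c ` mspace Y \<subseteq> Pow (D \<times> UNIV)" by (auto simp: c_def)
  qed
  ultimately have "inj_on (image (to_nat_on (D \<times> (UNIV :: nat set))) \<circ> c) (mspace Y)"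
    by (rule comp_inj_on)
  then have "mspace Y \<lesssim> (UNIV :: nat set set)" unfolding lepoll_def by blast
  then show ?thesis by (rule lepoll_trans2[OF _ nat_sets_eqpoll_reals])
qed

lemma polish_metric_isometric_real:
  fixes Y :: "'b metric"
  assumes "polish_metric Y"
  obtains Z :: "real metric" and j where "polish_metric Z" "onto_isometry Y Z j"
proof -
  obtain j :: "'b \<Rightarrow> real" where j: "inj_on j (mspace Y)"
    using separable_metric_lepoll_real assms by (auto simp: polish_metric_def lepoll_def)
  define i where "i = inv_into (mspace Y) j"
  define M where "M = j ` mspace Y"
  define d where "d u v = mdist Y (i u) (i v)" for u v
  have ij: "i (j x) = x" if "x \<in> mspace Y" for x
    using that j by (simp add: i_def)
  have iM: "i u \<in> mspace Y" "j (i u) = u" if "u \<in> M" for u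
    using that ij by (auto simp: M_def)
  interpret Y: Metric_space "mspace Y" "mdist Y" by (rule Metric_space_mspace_mdist)
  interpret Z: Metric_space M d
  proof
    show "d u v = 0 \<longleftrightarrow> u = v" if "u \<in> M" "v \<in> M" for u v
      using that iM by (metis d_def Y.zero)
    show "d u w \<le> d u v + d v w" if "u \<in> M" "v \<in> M" "w \<in> M" for u v w
      using that iM by (simp add: d_def Y.triangle)
  qed (simp_all add: d_def mdist_commute)
  interpret YZ: Metric_space12 "mspace Y" "mdist Y" M d ..
  have "homeomorphic_map Y.mtopology Z.mtopology j"
    by (rule YZ.isometry_imp_homeomorphic_map) (simp_all add: M_def d_def ij)
  then have "separable_space Z.mtopology"
    using assms homeomorphic_separable_space homeomorphic_map_imp_homeomorphic_space
    unfolding polish_metric_def mtopology_of_def by blast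
  moreover have "Z.mcomplete"
    unfolding Z.mcomplete_def
  proof (intro allI impI)
    fix \<sigma> assume \<sigma>: "Z.MCauchy \<sigma>"
    then have \<sigma>M: "\<sigma> n \<in> M" for n by (auto simp: Z.MCauchy_def)
    have "Y.MCauchy (i \<circ> \<sigma>)"
      using \<sigma> iM(1) \<sigma>M by (auto simp: Z.MCauchy_def Y.MCauchy_def d_def)
    then obtain y where "limitin Y.mtopology (i \<circ> \<sigma>) y sequentially"
      using assms by (auto simp: polish_metric_def mcomplete_of_def Y.mcomplete_def)
    then have "limitin Z.mtopology \<sigma> (j y) sequentially"
      unfolding Y.limitin_metric_dist_null Z.limitin_metric_dist_null
      by (auto simp: d_def ij \<sigma>M) (simp add: M_def)
    then show "\<exists>z. limitin Z.mtopology \<sigma> z sequentially" by blast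
  qed
  ultimately have "polish_metric (metric (M, d))"
    by (simp add: polish_metric_def mcomplete_of_def)
  moreover have "onto_isometry Y (metric (M, d)) j"
    by (auto simp: onto_isometry_def isometric_embedding_def M_def[symmetric] d_def ij)
      (simp add: M_def)
  ultimately show thesis by (rule that)
qed

lemma universal_metricD:
  fixes Y :: "'b metric"
  assumes "universal_metric X" "polish_metric Y"
  obtains f where "isometric_embedding Y X f"
proof -
  obtain Z :: "real metric" and j where Z: "polish_metric Z" "onto_isometry Y Z j"
    using polish_metric_isometric_real[OF assms(2)] .
  then obtain f where "isometric_embedding Z X f"
    using assms(1) unfolding universal_metric_def by blast
  then have "isometric_embedding Y X (f \<circ> j)"
    using Z(2) by (auto simp: isometric_embedding_def onto_isometry_def Pi_iff)
  then show thesis by (rule that)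
qed

end

theory Submission
  imports Defs
begin

text \<open>The points of the space are approximated by the elements of the countable group of exponent
  2 formed by the natural numbers under \<open>XOR\<close>. A map \<open>\<phi>\<close> of this group into the space is built on
  the subgroups \<open>{..<2 ^ n}\<close> successively, such that the distance of \<open>\<phi> x\<close> and \<open>\<phi> y\<close> depends on
  \<open>x XOR y\<close> only. Given any point \<open>u\<close>, the map extends to the next subgroup with \<open>2 ^ n \<mapsto> u\<close>:
  translation invariance forces the distance of the images of \<open>2 ^ n XOR x\<close> and \<open>y\<close> to be that of
  \<open>u\<close> and \<open>\<phi> (x XOR y)\<close>, the triangle inequality holds, and the resulting finite pseudometric
  space is realised by the extension property of the Urysohn space. Letting \<open>u\<close> run through a dense
  sequence, the range of \<open>\<phi>\<close> becomes dense, and by completeness the group structure extends to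
  the whole space, which then acts on itself by translations.\<close>

unbundle bit_operations_syntax

section \<open>Extension properties of the Urysohn space\<close>

lemma finite_polish_metric:
  fixes X :: "'a metric"
  assumes "finite (mspace X)"
  shows "polish_metric X"
proof -
  interpret Metric_space "mspace X" "mdist X" by (rule Metric_space_mspace_mdist)
  have "compact_space mtopology"
    using assms by (simp add: compact_space_def finite_imp_compactin)
  then have "mcomplete" by (rule compact_space_imp_mcomplete)
  moreover have "separable_space mtopology"
    unfolding separable_space_def
    using assms closure_of_topspace[of mtopology]
    by (intro exI[of _ "mspace X"]) (simp add: countable_finite)
  ultimately show ?thesis
    by (simp add: polish_metric_def mcomplete_of_def mtopology_of_def)
qed

lemma mdist_self: "x \<in> mspace X \<Longrightarrow> mdist X x x = 0"
  by simp

text \<open>The two inequalities make \<open>f\<close> a Katetov function: they are the triangle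
  inequalities for a new point at distance \<open>f i\<close> from each \<open>p i\<close>.
  Universality embeds the finite space enlarged by this point somewhere in \<open>U\<close>, and
  homogeneity moves the embedded copy of the old points back to their places.\<close>

lemma urysohn_one_point_extension:
  fixes U :: "'a metric" and p :: "'i \<Rightarrow> 'a" and f :: "'i \<Rightarrow> real"
  assumes U: "urysohn_space U" and I: "finite I" and p: "p ` I \<subseteq> mspace U"
    and f1: "\<And>i j. i \<in> I \<Longrightarrow> j \<in> I \<Longrightarrow> \<bar>f i - f j\<bar> \<le> mdist U (p i) (p j)"
    and f2: "\<And>i j. i \<in> I \<Longrightarrow> j \<in> I \<Longrightarrow> mdist U (p i) (p j) \<le> f i + f j"
  obtains u where "u \<in> mspace U" "\<And>i. i \<in> I \<Longrightarrow> mdist U u (p i) = f i"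
proof (cases "\<exists>i\<in>I. f i = 0")
  \<comment> \<open>Distance 0 would identify the new point with an old one, so here
    \<open>p i\<close> itself must be the solution; the abstract space below is built only for
    positive distances.\<close>
  case True
  then obtain i where i: "i \<in> I" "f i = 0" by blast
  have "mdist U (p i) (p j) = f j" if "j \<in> I" for j
    using f1[OF i(1) that] f2[OF i(1) that] i by linarith
  with i p show thesis by (intro that[of "p i"]) auto
next
  case False
  have pU: "p i \<in> mspace U" if "i \<in> I" for i using p that by blast
  have pos: "0 < f i" if "i \<in> I" for i
  proof -
    have "0 \<le> f i" using f2[OF that that] pU[OF that] by (simp add: mdist_self)
    with False that show ?thesis by force
  qed
  define A where "A = p ` I"
  \<comment> \<open>\<open>p\<close> may repeat points, but \<open>f\<close> agrees on indices with
    the same image, so it descends to a function on \<open>A\<close>. The absolute value makes it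
    nonnegative also off \<open>A\<close>, since \<open>Metric_space\<close> asks for nonnegativity
    at all arguments.\<close>
  define F where "F a = \<bar>f (inv_into I p a)\<bar>" for a
  have Fp: "F (p i) = f i" if "i \<in> I" for i
  proof -
    let ?j = "inv_into I p (p i)"
    have "?j \<in> I" "p ?j = p i"
      using that by (auto intro: inv_into_into f_inv_into_f)
    then have "\<bar>f ?j - f i\<bar> \<le> 0" using f1[of ?j i] that pU by (simp add: mdist_self)
    with pos[OF that] show ?thesis by (simp add: F_def)
  qed
  have AU: "a \<in> mspace U" if "a \<in> A" for a using that pU by (auto simp: A_def)
  have F0: "0 < F a" if "a \<in> A" for a using that pos Fp by (auto simp: A_def)
  have F1: "F a \<le> mdist U a b + F b" "F a \<le> F b + mdist U b a" "mdist U a b \<le> F a + F b"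
    if ab: "a \<in> A" "b \<in> A" for a b
  proof -
    obtain i j where ij: "i \<in> I" "j \<in> I" "a = p i" "b = p j" using ab unfolding A_def by blast
    have "\<bar>f i - f j\<bar> \<le> mdist U a b" "mdist U a b \<le> f i + f j" "F a = f i" "F b = f j"
      using f1 f2 Fp ij by auto
    then show "F a \<le> mdist U a b + F b" "F a \<le> F b + mdist U b a" "mdist U a b \<le> F a + F b"
      using mdist_commute[of U a b] by linarith+
  qed
  \<comment> \<open>\<open>None\<close> plays the new point and \<open>Some a\<close> the old point
    \<open>a\<close>.\<close>
  define M where "M = insert None (Some ` A)"
  define d where "d s t = (case (s, t) of
      (Some a, Some b) \<Rightarrow> mdist U a b | (Some a, None) \<Rightarrow> F a | (None, Some b) \<Rightarrow> F b
    | (None, None) \<Rightarrow> 0)" for s t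
  interpret Y: Metric_space M d
  proof
    show "0 \<le> d s t" for s t
      by (simp add: d_def F_def split: option.split)
    show "d s t = d t s" for s t
      by (auto simp: d_def mdist_commute split: option.split)
    show "d s t = 0 \<longleftrightarrow> s = t" if "s \<in> M" "t \<in> M" for s t
      using that AU by (auto simp: M_def d_def F0[THEN less_imp_not_eq2])
    show "d s r \<le> d s t + d t r" if "s \<in> M" "t \<in> M" "r \<in> M" for s t r
      using that F1 AU
      by (auto simp: M_def d_def mdist_triangle F0[THEN less_imp_le])
  qed
  have "finite M" by (simp add: M_def A_def I)
  then have "polish_metric (metric (M, d))" by (intro finite_polish_metric) simp
  then obtain g where g: "isometric_embedding (metric (M, d)) U g"
    using U universal_metricD unfolding urysohn_space_def by blast
  then have gU: "g s \<in> mspace U" and gd: "mdist U (g s) (g t) = d s t"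
    if "s \<in> M" "t \<in> M" for s t
    using that by (auto simp: isometric_embedding_def)
  \<comment> \<open>\<open>B\<close> is the embedded copy of the old points and \<open>h0\<close>
    takes it isometrically back onto \<open>A\<close>. Homogeneity extends \<open>h0\<close> to an
    isometry \<open>h\<close> of \<open>U\<close>, and \<open>h (g None)\<close> is the point
    sought.\<close>
  define B where "B = g ` Some ` A"
  define h0 where "h0 b = the (inv_into (Some ` A) g b)" for b
  have inj: "inj_on g (Some ` A)"
    by (metis (no_types, lifting) M_def Y.zero gd inj_onI insertCI)
  have h0: "h0 (g (Some a)) = a" if "a \<in> A" for a
    using that inj by (simp add: h0_def)
  have BU: "B \<subseteq> mspace U" using gU by (auto simp: B_def M_def)
  have "B \<inter> mspace U = B" "A \<inter> mspace U = A" using BU AU by auto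
  moreover have "h0 ` B = A" using h0 by (force simp: B_def)
  moreover have "mdist U (h0 b) (h0 c) = mdist U b c" if "b \<in> B" "c \<in> B" for b c
    using that h0 gd by (auto simp: B_def M_def d_def)
  ultimately have "onto_isometry (submetric U B) (submetric U A) h0"
    unfolding onto_isometry_def isometric_embedding_def by auto
  then obtain h where h: "onto_isometry U U h" "\<And>b. b \<in> B \<Longrightarrow> h b = h0 b"
    using U BU AU I unfolding urysohn_space_def homogeneous_metric_def A_def B_def
    by (metis (no_types, lifting) finite_imageI subsetI)
  have N: "None \<in> M" by (simp add: M_def)
  show thesis
  proof (rule that[of "h (g None)"])
    show "h (g None) \<in> mspace U"
      using h(1) gU[OF N N] by (auto simp: onto_isometry_def)
    fix i assume i: "i \<in> I"
    then have m: "p i \<in> A" "Some (p i) \<in> M" by (auto simp: A_def M_def)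
    then have "g (Some (p i)) \<in> B" by (auto simp: B_def)
    then have "h (g (Some (p i))) = p i" using h(2) h0 m by simp
    then have "mdist U (h (g None)) (p i) = mdist U (g None) (g (Some (p i)))"
      using h(1) gU[OF N N] gU[OF m(2) N]
      by (metis onto_isometry_def isometric_embedding_def)
    then show "mdist U (h (g None)) (p i) = f i"
      using gd[OF N m(2)] Fp[OF i] by (simp add: d_def)
  qed
qed

text \<open>The points of \<open>K\<close> are adjoined one at a time; \<open>D x\<close> is a
  Katetov function on the points already placed. \<open>D\<close> may be a pseudometric, which
  matters when a newly prescribed point coincides with an earlier one.\<close>

lemma urysohn_finite_extension:
  fixes U :: "'a metric" and p :: "'i \<Rightarrow> 'a" and D :: "'i \<Rightarrow> 'i \<Rightarrow> real"
  assumes U: "urysohn_space U" and K: "finite K" and IK: "I \<subseteq> K" and p: "p ` I \<subseteq> mspace U"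
    and D0: "\<And>k. k \<in> K \<Longrightarrow> D k k = 0"
    and Dsym: "\<And>k l. k \<in> K \<Longrightarrow> l \<in> K \<Longrightarrow> D k l = D l k"
    and Dtri: "\<And>k l m. k \<in> K \<Longrightarrow> l \<in> K \<Longrightarrow> m \<in> K \<Longrightarrow> D k m \<le> D k l + D l m"
    and pD: "\<And>i j. i \<in> I \<Longrightarrow> j \<in> I \<Longrightarrow> mdist U (p i) (p j) = D i j"
  obtains q where "q ` K \<subseteq> mspace U" "\<And>i. i \<in> I \<Longrightarrow> q i = p i"
    "\<And>k l. k \<in> K \<Longrightarrow> l \<in> K \<Longrightarrow> mdist U (q k) (q l) = D k l"
proof -
  have "\<exists>q. q ` (I \<union> J) \<subseteq> mspace U \<and> (\<forall>i\<in>I. q i = p i) \<and>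
      (\<forall>k\<in>I \<union> J. \<forall>l\<in>I \<union> J. mdist U (q k) (q l) = D k l)"
    if "finite J" "J \<subseteq> K" for J
    using that
  proof (induction J)
    case empty
    show ?case using p pD by (intro exI[of _ p]) auto
  next
    case (insert x J)
    then obtain q where q: "q ` (I \<union> J) \<subseteq> mspace U" "\<forall>i\<in>I. q i = p i"
      "\<And>k l. k \<in> I \<union> J \<Longrightarrow> l \<in> I \<union> J \<Longrightarrow> mdist U (q k) (q l) = D k l"
      by auto
    show ?case
    proof (cases "x \<in> I")
      case True
      then have "I \<union> insert x J = I \<union> J" by blast
      with q show ?thesis by (intro exI[of _ q]) auto
    next
      case False
      have sub: "I \<union> J \<subseteq> K" and x: "x \<in> K" using IK insert by auto
      have fin: "finite (I \<union> J)" using sub K by (rule finite_subset)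
      obtain u where u: "u \<in> mspace U" "\<And>k. k \<in> I \<union> J \<Longrightarrow> mdist U u (q k) = D x k"
      proof (rule urysohn_one_point_extension[OF U fin q(1), of "D x"])
        fix k l assume kl: "k \<in> I \<union> J" "l \<in> I \<union> J"
        then have "k \<in> K" "l \<in> K" using sub by auto
        then have "D x k \<le> D x l + D k l" "D x l \<le> D x k + D k l" "D k l \<le> D x k + D x l"
          using Dtri[of x l k] Dtri[of x k l] Dtri[of k x l] Dsym x by auto
        then show "\<bar>D x k - D x l\<bar> \<le> mdist U (q k) (q l)"
          "mdist U (q k) (q l) \<le> D x k + D x l"
          using q(3)[OF kl] by auto
      qed blast
      have xJ: "x \<notin> I \<union> J" using False insert by auto
      have u': "mdist U (q k) u = D k x" if "k \<in> I \<union> J" for k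
        using u(2)[OF that] that sub Dsym x by (metis mdist_commute subsetD)
      have "mdist U ((q(x := u)) k) ((q(x := u)) l) = D k l"
        if "k \<in> insert x (I \<union> J)" "l \<in> insert x (I \<union> J)" for k l
        using that u u' q(3) D0[OF x] xJ by (auto simp del: Un_iff)
      then show ?thesis
        using q(1,2) u(1) False xJ by (intro exI[of _ "q(x := u)"]) auto
    qed
  qed
  from this[OF K order_refl] IK that show thesis by (metis sup.absorb2)
qed


section \<open>A dense translation-invariant image of the natural numbers under XOR\<close>

lemma xor_less_power:
  fixes x y :: nat
  assumes "x < 2 ^ n" "y < 2 ^ n"
  shows "x XOR y < 2 ^ n"
  using assms by (metis take_bit_nat_eq_self_iff take_bit_xor)

text \<open>Such an \<open>x\<close> has bit \<open>n\<close> set and no higher bit, and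
  \<open>XOR\<close> with \<open>2 ^ n\<close> clears bit \<open>n\<close>. So the next subgroup is
  the old one together with its coset by \<open>2 ^ n\<close>.\<close>

lemma xor_top_bit_less:
  fixes x :: nat
  assumes "x < 2 ^ Suc n" "\<not> x < 2 ^ n"
  shows "x XOR 2 ^ n < 2 ^ n"
proof -
  have "x div 2 ^ n = 1" using assms by (intro div_nat_eqI) auto
  then have "bit x n" by (simp add: bit_iff_odd)
  moreover have "\<not> bit x m" if "n < m" for m
    using that assms(1) by (metis Suc_leI bit_take_bit_iff leD take_bit_nat_eq_self)
  ultimately have "take_bit n (x XOR 2 ^ n) = x XOR 2 ^ n"
    by (intro bit_eqI) (auto simp: bit_simps dest: nat_neq_iff[THEN iffD1])
  then show ?thesis by (metis take_bit_nat_less_exp)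
qed

lemma xor_cancel [simp]:
  fixes x y :: nat
  shows "x XOR (x XOR y) = y" "(x XOR y) XOR y = x"
  by (simp_all add: xor.assoc flip: xor.assoc[of x x])

lemma xor_map_extension:
  fixes U :: "'a metric" and \<phi> :: "nat \<Rightarrow> 'a"
  assumes U: "urysohn_space U" and u: "u \<in> mspace U" and \<phi>: "\<phi> ` {..<2 ^ n} \<subseteq> mspace U"
    and inv: "\<And>x y. x < 2 ^ n \<Longrightarrow> y < 2 ^ n \<Longrightarrow>
      mdist U (\<phi> x) (\<phi> y) = mdist U (\<phi> (x XOR y)) (\<phi> 0)"
  obtains \<psi> where "\<psi> ` {..<2 ^ Suc n} \<subseteq> mspace U" "\<And>x. x < 2 ^ n \<Longrightarrow> \<psi> x = \<phi> x" "\<psi> (2 ^ n) = u"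
    "\<And>x y. x < 2 ^ Suc n \<Longrightarrow> y < 2 ^ Suc n \<Longrightarrow>
      mdist U (\<psi> x) (\<psi> y) = mdist U (\<psi> (x XOR y)) (\<psi> 0)"
proof -
  have \<phi>U: "\<phi> x \<in> mspace U" if "x < 2 ^ n" for x using that \<phi> by auto
  \<comment> \<open>\<open>N w\<close> is the distance that invariance forces between the images of
    any two numbers whose \<open>XOR\<close> is \<open>w\<close>. For \<open>w\<close> in the new
    coset, the pair \<open>2 ^ n\<close> and \<open>w XOR 2 ^ n\<close> shows the value, as
    \<open>2 ^ n\<close> is to go to \<open>u\<close>.\<close>
  define N where "N w = (if w < 2 ^ n then mdist U (\<phi> w) (\<phi> 0) else mdist U u (\<phi> (w XOR 2 ^ n)))"
    for w
  have N_less: "N (x XOR y) = mdist U (\<phi> x) (\<phi> y)" if "x < 2 ^ n" "y < 2 ^ n" for x y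
    using inv[OF that] xor_less_power[OF that] by (simp add: N_def)
  have ge: "\<not> x XOR y < 2 ^ n" if "x < 2 ^ n" "\<not> y < 2 ^ n" for x y :: nat
    using that xor_less_power[of "x XOR y" n x] by (metis xor.commute xor_cancel(2))
  have N_ge: "N (x XOR y) = mdist U u (\<phi> (x XOR (y XOR 2 ^ n)))"
    if "x < 2 ^ n" "\<not> y < 2 ^ n" for x y
    using ge[OF that] by (simp add: N_def xor.assoc)
  \<comment> \<open>The triangle runs from \<open>u\<close> through \<open>\<phi> ?y\<close> to
    \<open>\<phi> (x XOR ?y)\<close>; its last side is \<open>N x\<close> by invariance on the old
    subgroup.\<close>
  have mixed: "N (x XOR y) \<le> N x + N y"
    if "x < 2 ^ n" "y < 2 ^ Suc n" "\<not> y < 2 ^ n" for x y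
  proof -
    let ?y = "y XOR 2 ^ n"
    have y: "?y < 2 ^ n" using that xor_top_bit_less by blast
    have "N (x XOR y) = mdist U u (\<phi> (x XOR ?y))" using that by (simp add: N_ge)
    also have "\<dots> \<le> mdist U u (\<phi> ?y) + mdist U (\<phi> ?y) (\<phi> (x XOR ?y))"
      using u y that xor_less_power \<phi>U by (intro mdist_triangle) auto
    also have "mdist U (\<phi> ?y) (\<phi> (x XOR ?y)) = N x"
      using inv[OF y xor_less_power[OF that(1) y]] that
      by (simp add: N_def xor.left_commute)
    finally show ?thesis using that by (simp add: N_def)
  qed
  \<comment> \<open>As \<open>x XOR z = (x XOR y) XOR (y XOR z)\<close>, subadditivity of
    \<open>N\<close> is the triangle inequality for the distance \<open>N (x XOR y)\<close>. In each
    combination of cosets it comes from a triangle in \<open>U\<close> among \<open>u\<close> and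
    values of \<open>\<phi>\<close>.\<close>
  have tri: "N (x XOR y) \<le> N x + N y" if x: "x < 2 ^ Suc n" and y: "y < 2 ^ Suc n" for x y
  proof -
    consider "x < 2 ^ n" "y < 2 ^ n" | "x < 2 ^ n" "\<not> y < 2 ^ n" | "\<not> x < 2 ^ n" "y < 2 ^ n"
      | "\<not> x < 2 ^ n" "\<not> y < 2 ^ n" by blast
    then show ?thesis
    proof cases
      case 1
      then show ?thesis
        using mdist_triangle[of "\<phi> x" U "\<phi> 0" "\<phi> y"] \<phi>U
        by (simp add: N_less) (simp add: N_def mdist_commute)
    next
      case 2
      then show ?thesis using mixed y by blast
    next
      case 3
      then show ?thesis using mixed[of y x] x by (simp add: xor.commute add.commute)
    next
      case 4
      let ?x = "x XOR 2 ^ n" and ?y = "y XOR 2 ^ n"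
      have lt: "?x < 2 ^ n" "?y < 2 ^ n" using 4 x y xor_top_bit_less by blast+
      have "N (x XOR y) = mdist U (\<phi> ?x) (\<phi> ?y)"
        using N_less[OF lt] by (simp add: xor.assoc xor.commute xor.left_commute)
      also have "\<dots> \<le> mdist U (\<phi> ?x) u + mdist U u (\<phi> ?y)"
        using lt \<phi>U u by (intro mdist_triangle) auto
      finally show ?thesis using 4 by (simp add: N_def mdist_commute)
    qed
  qed
  have N0: "N 0 = 0" using \<phi>U[of 0] by (simp add: N_def)
  \<comment> \<open>The values on \<open>{..2 ^ n}\<close>, the old subgroup together with
    \<open>2 ^ n\<close>, are prescribed and already have the distances given by \<open>N\<close>;
    the finite extension supplies the rest of the coset.\<close>
  define p where "p = \<phi>(2 ^ n := u)"
  obtain \<psi> where \<psi>: "\<psi> ` {..<2 ^ Suc n} \<subseteq> mspace U" "\<And>x. x \<in> {..2 ^ n} \<Longrightarrow> \<psi> x = p x"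
    "\<And>x y. x \<in> {..<2 ^ Suc n} \<Longrightarrow> y \<in> {..<2 ^ Suc n} \<Longrightarrow> mdist U (\<psi> x) (\<psi> y) = N (x XOR y)"
  proof (rule urysohn_finite_extension[OF U, of "{..<2 ^ Suc n}" "{..2 ^ n}" p "\<lambda>x y. N (x XOR y)"])
    show "{..2 ^ n} \<subseteq> {..<2 ^ Suc n :: nat}" by (auto intro: le_less_trans)
    show "p ` {..2 ^ n} \<subseteq> mspace U" using \<phi> u by (auto simp: p_def)
    show "N (x XOR z) \<le> N (x XOR y) + N (y XOR z)"
      if "x \<in> {..<2 ^ Suc n}" "y \<in> {..<2 ^ Suc n}" "z \<in> {..<2 ^ Suc n}" for x y z
      using that tri[of "x XOR y" "y XOR z"] xor_less_power[of _ "Suc n"]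
      by (simp add: xor.assoc xor.left_commute)
    show "mdist U (p x) (p y) = N (x XOR y)" if "x \<in> {..2 ^ n}" "y \<in> {..2 ^ n}" for x y
    proof -
      have c: "x < 2 ^ n \<or> x = 2 ^ n" "y < 2 ^ n \<or> y = 2 ^ n" using that by auto
      have "N (x XOR 2 ^ n) = mdist U u (\<phi> x)" if "x < 2 ^ n" for x
        using N_ge[OF that, of "2 ^ n"] by simp
      then show ?thesis
        using c N_less N0 u by (auto simp: p_def mdist_commute xor.commute)
    qed
  qed (auto simp: N0 xor.commute)
  show thesis
  proof (rule that[of \<psi>])
    show "mdist U (\<psi> x) (\<psi> y) = mdist U (\<psi> (x XOR y)) (\<psi> 0)"
      if "x < 2 ^ Suc n" "y < 2 ^ Suc n" for x y
      using that \<psi>(3)[of x y] \<psi>(3)[of "x XOR y" 0] xor_less_power[OF that] by simp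
  qed (use \<psi> in \<open>auto simp: p_def\<close>)
qed

text \<open>Over the empty family of points the conditions of the one-point extension are
  void.\<close>

lemma urysohn_nonempty:
  assumes "urysohn_space U"
  obtains u where "u \<in> mspace U"
proof (rule urysohn_one_point_extension[OF assms, of "{}" "\<lambda>_ :: unit. undefined" "\<lambda>_. 0"])
qed (use that in auto)

lemma urysohn_dense_xor_map:
  fixes U :: "'a metric"
  assumes U: "urysohn_space U"
  obtains \<phi> :: "nat \<Rightarrow> 'a" where "\<And>x. \<phi> x \<in> mspace U"
    "\<And>x y. mdist U (\<phi> x) (\<phi> y) = mdist U (\<phi> (x XOR y)) (\<phi> 0)"
    "\<And>u. u \<in> mspace U \<Longrightarrow> \<exists>c. (\<lambda>k. mdist U (\<phi> (c k)) u) \<longlonglongrightarrow> 0"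
proof -
  interpret Metric_space "mspace U" "mdist U" by (rule Metric_space_mspace_mdist)
  obtain u0 where u0: "u0 \<in> mspace U" using urysohn_nonempty[OF U] .
  obtain D where D: "countable D" "D \<subseteq> mspace U" "mtopology closure_of D = mspace U"
    using U by (auto simp: urysohn_space_def polish_metric_def separable_space_def mtopology_of_def)
  then have "D \<noteq> {}" using u0 by auto
  define s where "s = from_nat_into D"
  have s: "range s = D" using D(1) \<open>D \<noteq> {}\<close> by (simp add: s_def range_from_nat_into)
  \<comment> \<open>\<open>P n\<close> is invariance on the subgroup of size \<open>2 ^ n\<close>,
    and \<open>Q n\<close> says that the next map extends the present one and hits the
    \<open>n\<close>-th dense point. A stage-\<open>n\<close> map carries information only below
    \<open>2 ^ n\<close>.\<close>
  define P where "P n \<phi> \<longleftrightarrow> \<phi> ` {..<2 ^ n} \<subseteq> mspace U \<and>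
    (\<forall>x<2 ^ n. \<forall>y<2 ^ n. mdist U (\<phi> x) (\<phi> y) = mdist U (\<phi> (x XOR y)) (\<phi> 0))"
    for n and \<phi> :: "nat \<Rightarrow> 'a"
  define Q where "Q n \<phi> \<psi> \<longleftrightarrow> (\<forall>x<2 ^ n. \<psi> x = \<phi> x) \<and> \<psi> (2 ^ n) = s n"
    for n and \<phi> \<psi> :: "nat \<Rightarrow> 'a"
  have "\<exists>\<Phi>. \<forall>n. P n (\<Phi> n) \<and> Q n (\<Phi> n) (\<Phi> (Suc n))"
  proof (rule dependent_nat_choice)
    show "\<exists>\<phi>. P 0 \<phi>" using u0 by (intro exI[of _ "\<lambda>_. u0"]) (auto simp: P_def)
    fix \<phi> n assume \<phi>: "P n \<phi>"
    have "s n \<in> mspace U" using s D(2) by auto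
    then obtain \<psi> where "\<psi> ` {..<2 ^ Suc n} \<subseteq> mspace U" "\<And>x. x < 2 ^ n \<Longrightarrow> \<psi> x = \<phi> x"
      "\<psi> (2 ^ n) = s n" "\<And>x y. x < 2 ^ Suc n \<Longrightarrow> y < 2 ^ Suc n \<Longrightarrow>
        mdist U (\<psi> x) (\<psi> y) = mdist U (\<psi> (x XOR y)) (\<psi> 0)"
      using xor_map_extension[OF U, of "s n" \<phi> n] \<phi> unfolding P_def by blast
    then show "\<exists>\<psi>. P (Suc n) \<psi> \<and> Q n \<phi> \<psi>" unfolding P_def Q_def by blast
  qed
  then obtain \<Phi> where \<Phi>: "\<And>n. P n (\<Phi> n)" "\<And>n. Q n (\<Phi> n) (\<Phi> (Suc n))" by blast
  have stable: "\<Phi> m x = \<Phi> n x" if "x < 2 ^ n" "n \<le> m" for m n x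
    using that(2)
  proof (induction m rule: dec_induct)
    case (step m)
    have "x < 2 ^ m" using that(1) step(1) by (meson less_le_trans one_le_numeral power_increasing)
    with \<Phi>(2)[of m] step show ?case by (simp add: Q_def)
  qed simp
  \<comment> \<open>The diagonal is a legitimate choice because \<open>x < 2 ^ x\<close>: stage
    \<open>x\<close> has already fixed the value at \<open>x\<close>.\<close>
  define \<phi> where "\<phi> x = \<Phi> x x" for x
  have \<phi>: "\<phi> x = \<Phi> n x" if "x < 2 ^ n" for x n
    using stable[of x x n] stable[of x n x] that by (cases "n \<le> x") (auto simp: \<phi>_def)
  show thesis
  proof (rule that[of \<phi>])
    show "\<phi> x \<in> mspace U" for x
      using \<Phi>(1)[of x] by (auto simp: P_def \<phi>_def)
    show "mdist U (\<phi> x) (\<phi> y) = mdist U (\<phi> (x XOR y)) (\<phi> 0)" for x y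
    proof -
      define n where "n = max x y"
      have "x < 2 ^ n" "y < 2 ^ n"
        by (auto simp: n_def intro: le_less_trans[OF _ less_exp])
      moreover from this have "x XOR y < 2 ^ n" by (rule xor_less_power)
      ultimately have "x < 2 ^ n" "y < 2 ^ n" "x XOR y < 2 ^ n"
        "mdist U (\<Phi> n x) (\<Phi> n y) = mdist U (\<Phi> n (x XOR y)) (\<Phi> n 0)"
        using \<Phi>(1)[of n] unfolding P_def by blast+
      then show ?thesis using \<phi>[of x n] \<phi>[of y n] \<phi>[of "x XOR y" n] \<phi>[of 0 n] by simp
    qed
    fix u assume u: "u \<in> mspace U"
    have "\<exists>x. mdist U (\<phi> x) u < inverse (real (Suc k))" for k
    proof -
      have "u \<in> mtopology closure_of D" using D u by simp
      then obtain a where a: "a \<in> D" "mdist U u a < inverse (real (Suc k))"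
        unfolding metric_closure_of by (smt (verit) in_mball inverse_positive_iff_positive
          mem_Collect_eq of_nat_0_less_iff zero_less_Suc)
      then obtain n where "a = s n" using s by auto
      then have "\<phi> (2 ^ n) = a" using \<Phi>(2)[of n] \<phi>[of "2 ^ n" "Suc n"] by (simp add: Q_def)
      with a show ?thesis by (metis mdist_commute)
    qed
    then obtain c where c: "\<And>k. mdist U (\<phi> (c k)) u < inverse (real (Suc k))" by metis
    have "(\<lambda>k. mdist U (\<phi> (c k)) u) \<longlonglongrightarrow> 0"
      by (rule real_tendsto_sandwich[OF _ _ tendsto_const LIMSEQ_inverse_real_of_nat])
        (simp_all add: c less_imp_le del: of_nat_Suc)
    then show "\<exists>c. (\<lambda>k. mdist U (\<phi> (c k)) u) \<longlonglongrightarrow> 0" by blast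
  qed
qed


section \<open>The completed group operation\<close>

text \<open>By \<open>dist_xor\<close>, the distance pulled back along \<open>\<phi>\<close> is a
  translation-invariant pseudometric on the group of natural numbers under \<open>XOR\<close>; by
  \<open>dense\<close> and \<open>complete\<close>, \<open>U\<close> is its completion.\<close>

locale dense_xor_map =
  fixes U :: "'a metric" and \<phi> :: "nat \<Rightarrow> 'a"
  assumes complete: "mcomplete_of U"
    and in_space [simp]: "\<phi> x \<in> mspace U"
    and dist_xor: "mdist U (\<phi> x) (\<phi> y) = mdist U (\<phi> (x XOR y)) (\<phi> 0)"
    and dense: "u \<in> mspace U \<Longrightarrow> \<exists>c. (\<lambda>k. mdist U (\<phi> (c k)) u) \<longlonglongrightarrow> 0"
begin

text \<open>Points are approximated by sequences of group elements rather than of their images, so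
  that \<open>XOR\<close> can be applied termwise even where \<open>\<phi>\<close> is not
  injective.\<close>

definition approximates :: "(nat \<Rightarrow> nat) \<Rightarrow> 'a \<Rightarrow> bool" where
  "approximates c u \<longleftrightarrow> u \<in> mspace U \<and> (\<lambda>k. mdist U (\<phi> (c k)) u) \<longlonglongrightarrow> 0"

lemma approximates_in_space: "approximates c u \<Longrightarrow> u \<in> mspace U"
  by (simp add: approximates_def)

lemma approximates_const: "approximates (\<lambda>_. x) (\<phi> x)"
  by (simp add: approximates_def mdist_self)

lemma ex_approximates: "u \<in> mspace U \<Longrightarrow> \<exists>c. approximates c u"
  using dense by (auto simp: approximates_def)

text \<open>Regrouping \<open>(a XOR b) XOR (c XOR e)\<close> as
  \<open>(a XOR c) XOR (b XOR e)\<close> and passing through \<open>\<phi> 0\<close> bounds the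
  distance. This is the uniform continuity by which \<open>XOR\<close> extends to the
  completion.\<close>

lemma dist_xor_le:
  "mdist U (\<phi> (a XOR b)) (\<phi> (c XOR e)) \<le> mdist U (\<phi> a) (\<phi> c) + mdist U (\<phi> b) (\<phi> e)"
proof -
  have "mdist U (\<phi> (a XOR b)) (\<phi> (c XOR e)) = mdist U (\<phi> (a XOR c)) (\<phi> (b XOR e))"
    using dist_xor[of "a XOR b" "c XOR e"] dist_xor[of "a XOR c" "b XOR e"]
    by (simp add: xor.assoc xor.left_commute)
  also have "\<dots> \<le> mdist U (\<phi> (a XOR c)) (\<phi> 0) + mdist U (\<phi> 0) (\<phi> (b XOR e))"
    by (intro mdist_triangle) auto
  also have "\<dots> = mdist U (\<phi> a) (\<phi> c) + mdist U (\<phi> b) (\<phi> e)"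
    using dist_xor[of a c] dist_xor[of b e] by (simp add: mdist_commute)
  finally show ?thesis .
qed

lemma dist_tendsto:
  assumes "approximates b u" "approximates c v"
  shows "(\<lambda>k. mdist U (\<phi> (b k)) (\<phi> (c k))) \<longlonglongrightarrow> mdist U u v"
proof -
  have uv: "u \<in> mspace U" "v \<in> mspace U" using assms by (auto simp: approximates_def)
  have "(\<lambda>k. mdist U (\<phi> (b k)) u + mdist U (\<phi> (c k)) v) \<longlonglongrightarrow> 0 + 0"
    using assms by (intro tendsto_add) (auto simp: approximates_def)
  then have lim: "(\<lambda>k. mdist U (\<phi> (b k)) u + mdist U (\<phi> (c k)) v) \<longlonglongrightarrow> 0" by simp
  have le: "\<bar>mdist U (\<phi> (b k)) (\<phi> (c k)) - mdist U u v\<bar> \<le>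
      mdist U (\<phi> (b k)) u + mdist U (\<phi> (c k)) v" for k
    using mdist_triangle[of "\<phi> (b k)" U u "\<phi> (c k)"] mdist_triangle[of u U v "\<phi> (c k)"]
      mdist_triangle[of u U "\<phi> (b k)" v] mdist_triangle[of "\<phi> (b k)" U "\<phi> (c k)" v]
      uv mdist_commute[of U] by (smt (verit) in_space)
  have "(\<lambda>k. mdist U (\<phi> (b k)) (\<phi> (c k)) - mdist U u v) \<longlonglongrightarrow> 0"
    by (rule Lim_null_comparison[OF _ lim]) (simp add: le)
  then show ?thesis by (rule LIM_zero_cancel)
qed

lemma approximates_close:
  assumes "approximates b u" "(\<lambda>k. mdist U (\<phi> (b k)) (\<phi> (c k))) \<longlonglongrightarrow> 0"
  shows "approximates c u"
proof -
  have u: "u \<in> mspace U" using assms by (auto simp: approximates_def)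
  have lim: "(\<lambda>k. mdist U (\<phi> (b k)) (\<phi> (c k)) + mdist U (\<phi> (b k)) u) \<longlonglongrightarrow> 0 + 0"
    using assms by (intro tendsto_add) (auto simp: approximates_def)
  have le: "mdist U (\<phi> (c k)) u \<le> mdist U (\<phi> (b k)) (\<phi> (c k)) + mdist U (\<phi> (b k)) u" for k
    using mdist_triangle[of "\<phi> (c k)" U "\<phi> (b k)" u] u mdist_commute[of U] by auto
  have "(\<lambda>k. mdist U (\<phi> (c k)) u) \<longlonglongrightarrow> 0"
    by (rule real_tendsto_sandwich[OF _ _ tendsto_const lim[simplified]]) (simp_all add: le)
  with u show ?thesis by (simp add: approximates_def)
qed

lemma approximates_unique:
  assumes "approximates c u" "approximates c v"
  shows "u = v"
proof -
  have "(\<lambda>k. 0) \<longlonglongrightarrow> mdist U u v" using dist_tendsto[OF assms] by (simp add: mdist_self)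
  then have "mdist U u v = 0" by (simp add: LIMSEQ_const_iff)
  with assms show ?thesis by (simp add: approximates_def)
qed

text \<open>The group operation of the completion. The description ranges over all approximating
  sequences, so no choice of them enters the value.\<close>

definition translate :: "'a \<Rightarrow> 'a \<Rightarrow> 'a" where
  "translate u v = (THE w. \<forall>b c. approximates b u \<longrightarrow> approximates c v \<longrightarrow>
     approximates (\<lambda>k. b k XOR c k) w)"

text \<open>By \<open>dist_xor_le\<close> the termwise \<open>XOR\<close> is a Cauchy sequence and
  converges by completeness. The same bound shows that another pair of approximating sequences leads
  to the same limit, so the description in \<open>translate\<close> is well defined.\<close>

lemma approximates_translate:
  assumes b: "approximates b u" and c: "approximates c v"
  shows "approximates (\<lambda>k. b k XOR c k) (translate u v)"
proof -
  interpret Metric_space "mspace U" "mdist U" by (rule Metric_space_mspace_mdist)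
  have "MCauchy (\<lambda>k. \<phi> (b k XOR c k))"
    unfolding MCauchy_def
  proof (intro conjI allI impI)
    fix e :: real assume "0 < e"
    have "(\<lambda>k. mdist U (\<phi> (b k)) u + mdist U (\<phi> (c k)) v) \<longlonglongrightarrow> 0 + 0"
      using b c by (intro tendsto_add) (auto simp: approximates_def)
    then have "\<forall>\<^sub>F k in sequentially. mdist U (\<phi> (b k)) u + mdist U (\<phi> (c k)) v < e / 2"
      using \<open>0 < e\<close> by (intro order_tendstoD(2)) auto
    then obtain N where N: "\<And>k. N \<le> k \<Longrightarrow> mdist U (\<phi> (b k)) u + mdist U (\<phi> (c k)) v < e / 2"
      by (auto simp: eventually_sequentially)
    have "mdist U (\<phi> (b m XOR c m)) (\<phi> (b n XOR c n)) < e" if "N \<le> m" "N \<le> n" for m n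
    proof -
      have "mdist U (\<phi> (b m)) (\<phi> (b n)) \<le> mdist U (\<phi> (b m)) u + mdist U (\<phi> (b n)) u"
        "mdist U (\<phi> (c m)) (\<phi> (c n)) \<le> mdist U (\<phi> (c m)) v + mdist U (\<phi> (c n)) v"
        using mdist_triangle[of "\<phi> (b m)" U u "\<phi> (b n)"] mdist_triangle[of "\<phi> (c m)" U v "\<phi> (c n)"]
          b c by (auto simp: approximates_def mdist_commute)
      with dist_xor_le[of "b m" "c m" "b n" "c n"] N[OF that(1)] N[OF that(2)]
      show ?thesis by linarith
    qed
    then show "\<exists>N. \<forall>n n'. N \<le> n \<longrightarrow> N \<le> n' \<longrightarrow>
        mdist U (\<phi> (b n XOR c n)) (\<phi> (b n' XOR c n')) < e" by blast
  qed auto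
  then obtain w where "limitin mtopology (\<lambda>k. \<phi> (b k XOR c k)) w sequentially"
    using complete by (auto simp: mcomplete_of_def mcomplete_def)
  then have w: "approximates (\<lambda>k. b k XOR c k) w"
    by (auto simp: limitin_metric_dist_null approximates_def)
  have w': "approximates (\<lambda>k. b' k XOR c' k) w"
    if b': "approximates b' u" and c': "approximates c' v" for b' c'
  proof (rule approximates_close[OF w])
    have "(\<lambda>k. mdist U (\<phi> (b k)) (\<phi> (b' k)) + mdist U (\<phi> (c k)) (\<phi> (c' k))) \<longlonglongrightarrow>
        mdist U u u + mdist U v v"
      by (intro tendsto_add dist_tendsto b b' c c')
    also have "mdist U u u + mdist U v v = 0" using b c by (simp add: approximates_def mdist_self)
    finally have lim: "(\<lambda>k. mdist U (\<phi> (b k)) (\<phi> (b' k)) + mdist U (\<phi> (c k)) (\<phi> (c' k))) \<longlonglongrightarrow> 0" .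
    show "(\<lambda>k. mdist U (\<phi> (b k XOR c k)) (\<phi> (b' k XOR c' k))) \<longlonglongrightarrow> 0"
      by (rule real_tendsto_sandwich[OF _ _ tendsto_const lim]) (auto simp: dist_xor_le)
  qed
  then have "translate u v = w"
    unfolding translate_def using b c approximates_unique by (intro the_equality) blast+
  with w show ?thesis by simp
qed

lemma translate_closed [simp]:
  assumes "u \<in> mspace U" "v \<in> mspace U"
  shows "translate u v \<in> mspace U"
  using assms ex_approximates approximates_translate approximates_in_space by meson

text \<open>This and the next group laws pass from \<open>XOR\<close> to the limit: both sides are
  approximated by the same sequence, and such limits are unique.\<close>

lemma translate_commute:
  assumes "u \<in> mspace U" "v \<in> mspace U"
  shows "translate u v = translate v u"
proof -
  obtain b c where "approximates b u" "approximates c v" using assms ex_approximates by meson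
  then show ?thesis
    using approximates_translate[of b u c v] approximates_translate[of c v b u]
    by (auto simp: xor.commute intro: approximates_unique)
qed

lemma translate_assoc:
  assumes "u \<in> mspace U" "v \<in> mspace U" "w \<in> mspace U"
  shows "translate (translate u v) w = translate u (translate v w)"
proof -
  obtain a b c where a: "approximates a u" and b: "approximates b v" and c: "approximates c w"
    using assms ex_approximates by meson
  have "approximates (\<lambda>k. (a k XOR b k) XOR c k) (translate (translate u v) w)"
    "approximates (\<lambda>k. a k XOR (b k XOR c k)) (translate u (translate v w))"
    using approximates_translate[OF approximates_translate[OF a b] c]
      approximates_translate[OF a approximates_translate[OF b c]] by simp_all
  then show ?thesis by (auto simp: xor.assoc intro: approximates_unique)
qed

lemma translate_zero:
  assumes "u \<in> mspace U"
  shows "translate (\<phi> 0) u = u"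
proof -
  obtain c where c: "approximates c u" using assms ex_approximates by meson
  then show ?thesis
    using approximates_translate[OF approximates_const[of 0] c] by (auto intro: approximates_unique)
qed

lemma translate_self:
  assumes "u \<in> mspace U"
  shows "translate u u = \<phi> 0"
proof -
  obtain c where c: "approximates c u" using assms ex_approximates by meson
  then show ?thesis
    using approximates_translate[OF c c] approximates_const[of 0] by (simp add: approximates_unique)
qed

text \<open>For group elements this is invariance, since \<open>a\<close> cancels in
  \<open>(a XOR b) XOR (a XOR c)\<close>; the equality of distances survives the limit.\<close>

lemma dist_translate:
  assumes "u \<in> mspace U" "v \<in> mspace U" "w \<in> mspace U"
  shows "mdist U (translate u v) (translate u w) = mdist U v w"
proof -
  obtain a b c where abc: "approximates a u" "approximates b v" "approximates c w"
    using assms[THEN ex_approximates] by blast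
  have "mdist U (\<phi> (a k XOR b k)) (\<phi> (a k XOR c k)) = mdist U (\<phi> (b k)) (\<phi> (c k))" for k
    using dist_xor[of "a k XOR b k" "a k XOR c k"] dist_xor[of "b k" "c k"]
    by (simp add: xor.assoc xor.commute xor.left_commute)
  then show ?thesis
    using dist_tendsto[OF approximates_translate[OF abc(1,2)] approximates_translate[OF abc(1,3)]]
      dist_tendsto[OF abc(2,3)] by (simp add: LIMSEQ_unique)
qed


section \<open>The group of translations\<close>

definition translation :: "'a \<Rightarrow> 'a \<Rightarrow> 'a" where
  "translation u = (\<lambda>v\<in>mspace U. translate u v)"

text \<open>Translations are involutions, so each is the witness for its own bijectivity.\<close>

lemma translate_cancel:
  assumes "u \<in> mspace U" "v \<in> mspace U"
  shows "translate u (translate u v) = v"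
  using assms by (simp add: translate_self translate_zero flip: translate_assoc)

lemma translation_in_Bij:
  assumes "u \<in> mspace U"
  shows "translation u \<in> Bij (mspace U)"
proof -
  have "bij_betw (translation u) (mspace U) (mspace U)"
    by (rule bij_betw_byWitness[of _ "translation u"])
      (use assms in \<open>auto simp: translation_def translate_cancel\<close>)
  then show ?thesis by (simp add: Bij_def translation_def)
qed

lemma translation_in_isometry_group:
  assumes "u \<in> mspace U"
  shows "translation u \<in> carrier (isometry_group U)"
proof -
  have "translation u ` mspace U = mspace U"
    using translation_in_Bij[OF assms] by (simp add: Bij_def bij_betw_def)
  then show ?thesis
    using assms translation_in_Bij[OF assms]
    by (auto simp: isometry_group_def onto_isometry_def isometric_embedding_def translation_def
        dist_translate)
qed

lemma translation_mult:
  assumes "u \<in> mspace U" "v \<in> mspace U"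
  shows "translation u \<otimes>\<^bsub>isometry_group U\<^esub> translation v = translation (translate u v)"
proof -
  have "translation u \<otimes>\<^bsub>isometry_group U\<^esub> translation v =
      compose (mspace U) (translation u) (translation v)"
    using assms by (simp add: isometry_group_def BijGroup_def translation_in_Bij)
  also have "\<dots> = translation (translate u v)"
    using assms by (auto simp: compose_def translation_def translate_assoc)
  finally show ?thesis .
qed

lemma translation_zero: "translation (\<phi> 0) = \<one>\<^bsub>isometry_group U\<^esub>"
  by (auto simp: translation_def translate_zero isometry_group_def BijGroup_def)

lemma translation_square:
  assumes "u \<in> mspace U"
  shows "translation u \<otimes>\<^bsub>isometry_group U\<^esub> translation u = \<one>\<^bsub>isometry_group U\<^esub>"
  using assms by (simp add: translation_mult translate_self translation_zero)

lemma subgroup_translations: "subgroup (translation ` mspace U) (isometry_group U)"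
proof -
  interpret group "isometry_group U" by (rule group_isometry_group)
  show ?thesis
  proof (rule subgroupI)
    show "translation ` mspace U \<subseteq> carrier (isometry_group U)"
      using translation_in_isometry_group by blast
    show "translation ` mspace U \<noteq> {}" using in_space by blast
    fix f assume "f \<in> translation ` mspace U"
    then obtain u where u: "u \<in> mspace U" "f = translation u" by blast
    have "inv\<^bsub>isometry_group U\<^esub> f = f"
      unfolding u(2) by (rule inv_equality)
        (simp_all only: translation_square translation_in_isometry_group u(1))
    with u show "inv\<^bsub>isometry_group U\<^esub> f \<in> translation ` mspace U" by simp
  next
    fix f g assume "f \<in> translation ` mspace U" "g \<in> translation ` mspace U"
    then show "f \<otimes>\<^bsub>isometry_group U\<^esub> g \<in> translation ` mspace U"
      by (auto simp: translation_mult)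
  qed
qed

abbreviation translation_group :: "('a \<Rightarrow> 'a) monoid" where
  "translation_group \<equiv> (isometry_group U)\<lparr>carrier := translation ` mspace U\<rparr>"

lemma comm_group_translations: "comm_group translation_group"
proof -
  interpret group translation_group
    by (rule subgroup.subgroup_is_group[OF subgroup_translations group_isometry_group])
  show ?thesis
    by (rule group_comm_groupI) (auto simp: translation_mult translate_commute)
qed

lemma transitive_translations:
  "transitive_action translation_group (mspace U) (\<lambda>h. h)"
proof -
  interpret group translation_group
    by (rule subgroup.subgroup_is_group[OF subgroup_translations group_isometry_group])
  have "carrier (BijGroup (mspace U)) = Bij (mspace U)" by (simp add: BijGroup_def)
  then have "(\<lambda>h. h) \<in> hom translation_group (BijGroup (mspace U))"
    using translation_in_Bij by (auto simp: hom_def isometry_group_def)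
  then have hom: "group_hom translation_group (BijGroup (mspace U)) (\<lambda>h. h)"
    by (simp add: group_hom_def group_hom_axioms_def group_BijGroup is_group)
  have trans: "\<exists>g\<in>carrier translation_group. g x = y" if "x \<in> mspace U" "y \<in> mspace U" for x y
  proof -
    \<comment> \<open>The translation by the sum of \<open>y\<close> and \<open>x\<close> takes
      \<open>x\<close> to \<open>y\<close>, because \<open>x\<close> added to itself is the zero
      \<open>\<phi> 0\<close>.\<close>
    have "translation (translate y x) x = translate y (translate x x)"
      using that by (simp add: translation_def translate_assoc)
    also have "\<dots> = y"
      using that by (simp add: translate_self translate_zero translate_commute[of y "\<phi> 0"])
    finally show ?thesis using that by auto
  qed
  show ?thesis
    unfolding transitive_action_def transitive_action_axioms_def group_action_def
    using hom trans by blast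
qed

text \<open>All squares are trivial, and the only smaller candidate is exponent 1. The translation
  by \<open>u\<close> excludes it, as it moves \<open>\<phi> 0\<close> to \<open>u\<close>.\<close>

lemma has_exponent_translations:
  assumes "u \<in> mspace U" "u \<noteq> \<phi> 0"
  shows "has_exponent translation_group 2"
proof -
  interpret group translation_group
    by (rule subgroup.subgroup_is_group[OF subgroup_translations group_isometry_group])
  have sq: "f [^]\<^bsub>translation_group\<^esub> (2::nat) = \<one>\<^bsub>translation_group\<^esub>"
    if "f \<in> carrier translation_group" for f
    using that l_one[OF that] translation_square by (auto simp: numeral_2_eq_2)
  have "2 \<le> m" if m: "0 < m"
    "\<forall>f\<in>carrier translation_group. f [^]\<^bsub>translation_group\<^esub> m = \<one>\<^bsub>translation_group\<^esub>" for m :: nat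
  proof (rule ccontr)
    assume "\<not> 2 \<le> m"
    then have "m = 1" using m(1) by simp
    have car: "translation u \<in> carrier translation_group" using assms by simp
    then have "translation u = \<one>\<^bsub>translation_group\<^esub>"
      using m(2)[rule_format, OF car] \<open>m = 1\<close> l_one[OF car] by simp
    then have "translation u (\<phi> 0) = translation (\<phi> 0) (\<phi> 0)"
      using translation_zero by simp
    then have "translate (\<phi> 0) u = translate (\<phi> 0) (\<phi> 0)"
      using assms by (simp add: translation_def translate_commute)
    then show False using assms by (simp add: translate_zero)
  qed
  with sq show ?thesis by (simp add: has_exponent_def)
qed

end

theorem proposition14:
  fixes U :: "'a metric"
  assumes "urysohn_space U"
  shows "\<exists>H. subgroup H (isometry_group U) \<and>
             comm_group ((isometry_group U)\<lparr>carrier := H\<rparr>) \<and>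
             has_exponent ((isometry_group U)\<lparr>carrier := H\<rparr>) 2 \<and>
             transitive_action ((isometry_group U)\<lparr>carrier := H\<rparr>) (mspace U) (\<lambda>h. h)"
proof (rule urysohn_dense_xor_map[OF assms])
  fix \<phi> :: "nat \<Rightarrow> 'a"
  assume \<phi>: "\<And>x. \<phi> x \<in> mspace U"
    "\<And>x y. mdist U (\<phi> x) (\<phi> y) = mdist U (\<phi> (x XOR y)) (\<phi> 0)"
    "\<And>u. u \<in> mspace U \<Longrightarrow> \<exists>c. (\<lambda>k. mdist U (\<phi> (c k)) u) \<longlonglongrightarrow> 0"
  have "mcomplete_of U" using assms by (simp add: urysohn_space_def polish_metric_def)
  then interpret dense_xor_map U \<phi> by (rule dense_xor_map.intro) (fact \<phi>)+
  \<comment> \<open>A point other than the zero is needed for the exponent to be exactly 2; the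
    one-point extension over the single point \<open>\<phi> 0\<close> gives one at distance
    1.\<close>
  obtain u where u: "u \<in> mspace U" "mdist U u (\<phi> 0) = 1"
  proof (rule urysohn_one_point_extension[OF assms, of "{0}" \<phi> "\<lambda>_. 1"])
  qed (use that in \<open>auto simp: mdist_self\<close>)
  then have "u \<noteq> \<phi> 0" by (auto simp: mdist_self)
  then show ?thesis
    using subgroup_translations comm_group_translations transitive_translations
      has_exponent_translations u(1) by blast
qed

end
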